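(* Let $G$ be a finite nontrivial group. Then $\Theta(G)$ is a split graph if and only if one of the following conditions holds: (i) $G\setminus P(G)=\varnothing$. (ii) There is a fixed prime $p$ such that $G\setminus P(G)$ consists exclusively of elements whose order is of the form $p^k$ with $k\geq 2$ (where $k$ may depend on the element). (iii) There are fixed distinct primes $p$ and $q$ such that $G\setminus P(G)$ consists exclusively of elements of order $pq$.
   Context: For a finite group $G$, $|g|$ denotes the order of $g\in G$. The prime-coprime graph $\Theta(G)$ is the simple graph with vertex set $G$ in which two distinct vertices $g,h$ are adjacent if and only if $\gcd(|g|,|h|)$ is either $1$ or a prime. Let $\pi(G)$ be the set of prime divisors of $|G|$ and $P(G)=\{g\in G : |g|\in\pi(G)\cup\{1\}\}$. A graph is a split graph if its vertex set can be partitioned into two disjoint nonempty subsets $K$ and $I$ such that $K$ is a clique and $I$ is an independent set. *)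

theory Defs
  imports
    "HOL-Library.Ramsey"
    "HOL-Computational_Algebra.Primes"
    "HOL-Algebra.Multiplicative_Group"
begin

text \<open>A simple graph is a pair of a vertex set and a set of two-element edges, the edge
  format of \<^const>\<open>clique\<close> and \<^const>\<open>indep\<close>.\<close>

definition split_graph :: "'a set \<times> 'a set set \<Rightarrow> bool" where
  "split_graph \<Gamma> \<longleftrightarrow> (case \<Gamma> of (V, E) \<Rightarrow>
     \<exists>K I. K \<union> I = V \<and> K \<inter> I = {} \<and> K \<noteq> {} \<and> I \<noteq> {} \<and> clique K E \<and> indep I E)"

definition prime_coprime_graph :: "('a, 'b) monoid_scheme \<Rightarrow> 'a set \<times> 'a set set" where
  "prime_coprime_graph G = (carrier G,
     {{g, h} | g h. g \<in> carrier G \<and> h \<in> carrier G \<and> g \<noteq> h \<and>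
        (gcd (group.ord G g) (group.ord G h) = 1 \<or>
         prime (gcd (group.ord G g) (group.ord G h)))})"

definition prime_divisors :: "('a, 'b) monoid_scheme \<Rightarrow> nat set" where
  "prime_divisors G = {p. prime p \<and> p dvd order G}"

definition prime_order_elements :: "('a, 'b) monoid_scheme \<Rightarrow> 'a set" where
  "prime_order_elements G = {g \<in> carrier G. group.ord G g \<in> prime_divisors G \<union> {1}}"

end

theory Submission
  imports Defs
begin

text \<open>An element \<open>g\<close> of composite order is distinct from its inverse and not adjacent to it, so the
  independent part meets \<open>{g, inv g}\<close>. Hence the orders of any two elements of composite order
  have a composite gcd. Composite orders are closed under composite divisors, so some
  \<open>p * q\<close> with \<open>p\<close> and \<open>q\<close> prime occurs as an order unless there are none, and then it divides
  every composite order; this forces (ii) if \<open>p = q\<close> and (iii) otherwise. Conversely, the elements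
  of order one or prime form a clique whose complement is independent in each of the three cases.\<close>

section \<open>Arithmetic of sets of composite numbers\<close>

lemma dvd_prime_mult_nonprime_eq:
  fixes d p q :: nat
  assumes "prime p" "prime q" "d dvd p * q" "d \<noteq> 1" "\<not> prime d"
  shows "d = p * q"
proof -
  obtain b c where bc: "d = b * c" "b dvd p" "c dvd q"
    using division_decomp[OF assms(3)] by blast
  then have "b = 1 \<or> b = p" "c = 1 \<or> c = q"
    using assms(1,2) by (auto simp: prime_nat_iff)
  with bc(1) assms show ?thesis by auto
qed

lemma prime_mult_dvd_imp_not_prime:
  fixes p q n :: nat
  assumes p: "prime p" and q: "prime q" and dvd: "p * q dvd n"
  shows "n \<noteq> 1 \<and> \<not> prime n"
proof -
  have "p * q \<noteq> 1" using p by auto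
  moreover have "\<not> prime (p * q)"
    using p q by (metis not_prime_1 prime_product)
  moreover have "p * q = 1 \<or> p * q = n" if "n = 1 \<or> prime n"
    using that dvd by (metis dvd_1_iff_1 One_nat_def prime_nat_iff)
  ultimately show ?thesis by auto
qed

text \<open>Here \<open>C\<close> stands for the set of composite orders, so the argument is pure
  arithmetic. A further prime factor \<open>r\<close> of some element would by closure put a product
  such as \<open>p * r\<close> into \<open>C\<close>, and \<open>p * q\<close> must divide that too,
  which pins \<open>r\<close> down.\<close>

lemma composite_orders_cases:
  fixes C :: "nat set"
  assumes composite: "\<And>n. n \<in> C \<Longrightarrow> n > 0 \<and> n \<noteq> 1 \<and> \<not> prime n"
    and closed: "\<And>n d. n \<in> C \<Longrightarrow> d dvd n \<Longrightarrow> d \<noteq> 1 \<Longrightarrow> \<not> prime d \<Longrightarrow> d \<in> C"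
    and gcds: "\<And>m n. m \<in> C \<Longrightarrow> n \<in> C \<Longrightarrow> gcd m n \<noteq> 1 \<and> \<not> prime (gcd m n)"
    and "C \<noteq> {}"
  shows "(\<exists>p. prime p \<and> (\<forall>n\<in>C. \<exists>k\<ge>2. n = p ^ k)) \<or>
    (\<exists>p q. prime p \<and> prime q \<and> p \<noteq> q \<and> (\<forall>n\<in>C. n = p * q))"
proof -
  obtain n where n: "n \<in> C" using \<open>C \<noteq> {}\<close> by blast
  then obtain p where p: "prime p" "p dvd n"
    using composite prime_factor_nat by blast
  then obtain c where c: "n = p * c" by (auto elim: dvdE)
  with n p composite[of n] have "c \<noteq> 1" by auto
  \<comment> \<open>Since \<open>q\<close> is taken from the cofactor of \<open>p\<close>, the
    product \<open>p * q\<close> divides \<open>n\<close> even when \<open>q = p\<close>.\<close>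
  then obtain q where q: "prime q" "q dvd c" using prime_factor_nat by blast
  have mem: "r * s \<in> C" if "m \<in> C" "r * s dvd m" "prime r" "prime s" for m r s
    using closed[OF that(1,2)] prime_mult_dvd_imp_not_prime[OF that(3,4) dvd_refl] by blast
  have pq: "p * q \<in> C" using mem[OF n _ p(1) q(1)] c q by auto
  have dvd: "p * q dvd m" if "m \<in> C" for m
  proof -
    \<comment> \<open>The only divisor of \<open>p * q\<close> that is neither 1 nor prime is
      \<open>p * q\<close> itself.\<close>
    have "gcd (p * q) m = p * q"
      using dvd_prime_mult_nonprime_eq[OF p(1) q(1) gcd_dvd1] gcds[OF pq that] by blast
    then show ?thesis by (metis gcd_dvd2)
  qed
  show ?thesis
  proof (cases "p = q")
    case True
    have "\<exists>k\<ge>2. m = p ^ k" if m: "m \<in> C" for m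
    proof -
      have "m > 0" using composite[OF m] by blast
      moreover have "\<not> is_unit p" using p(1) by auto
      \<comment> \<open>Split off the full power of \<open>p\<close>; any prime factor of the rest
        \<open>y\<close> would differ from \<open>p\<close>.\<close>
      ultimately obtain y where y: "m = p ^ multiplicity p m * y" "\<not> p dvd y"
        using multiplicity_decompose'[of m p] by auto
      have "y = 1"
      proof (rule ccontr)
        assume "y \<noteq> 1"
        then obtain r where r: "prime r" "r dvd y" using prime_factor_nat by blast
        then have "r \<noteq> p" using y(2) by blast
        then have "coprime p r" using p(1) r(1) by (simp add: primes_coprime)
        moreover have "r dvd m" by (subst y(1)) (simp add: r(2))
        moreover have "p dvd m" using dvd[OF m] by (rule dvd_mult_left)
        ultimately have "p * r dvd m" by (simp add: divides_mult)
        \<comment> \<open>The product \<open>p * r\<close> divides \<open>m\<close>, hence lies in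
          \<open>C\<close>, and \<open>p * q\<close> is \<open>p * p\<close> here.\<close>
        then have "p * p dvd p * r" using dvd[OF mem[OF m _ p(1) r(1)]] True by blast
        then have "p dvd r" using p(1) by (simp add: prime_gt_0_nat)
        then show False using primes_dvd_imp_eq[OF p(1) r(1)] \<open>r \<noteq> p\<close> by simp
      qed
      moreover have "multiplicity p m \<ge> 2"
        using dvd[OF m] True \<open>m > 0\<close> \<open>\<not> is_unit p\<close>
        by (simp add: power_dvd_iff_le_multiplicity[symmetric] power2_eq_square)
      ultimately show ?thesis using y(1) by auto
    qed
    with p(1) show ?thesis by blast
  next
    case False
    have "m = p * q" if m: "m \<in> C" for m
    proof (rule ccontr)
      assume ne: "m \<noteq> p * q"
      obtain c where c: "m = p * q * c" using dvd[OF m] by (auto elim: dvdE)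
      with ne have "c \<noteq> 1" by auto
      then obtain r where r: "prime r" "r dvd c" using prime_factor_nat by blast
      \<comment> \<open>Both products lie in \<open>C\<close>, so \<open>p * q\<close> divides both;
        this makes \<open>r\<close> equal to \<open>q\<close> and to \<open>p\<close> at
        once.\<close>
      have "p * r dvd m" "q * r dvd m" using c r(2) by auto
      then have "p * q dvd p * r" "p * q dvd q * r"
        using dvd mem[OF m _ p(1) r(1)] mem[OF m _ q(1) r(1)] by blast+
      then have "q dvd r" "p dvd r"
        using p(1) q(1) by (simp_all add: prime_gt_0_nat mult.commute[of p q])
      then show False
        using primes_dvd_imp_eq[OF p(1) r(1)] primes_dvd_imp_eq[OF q(1) r(1)] False by simp
    qed
    with p(1) q(1) False show ?thesis by blast
  qed
qed

section \<open>Element orders and adjacency\<close>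

lemma (in group) ord_divisor_attained:
  assumes "finite (carrier G)" "g \<in> carrier G" "d dvd ord g"
  obtains h where "h \<in> carrier G" "ord h = d"
proof -
  have pos: "ord g > 0" using ord_ge_1[OF assms(1,2)] by simp
  obtain c where c: "ord g = d * c" using assms(3) by (auto elim: dvdE)
  with pos have "c > 0" by (cases c) auto
  \<comment> \<open>The gcd of \<open>d * c\<close> and \<open>c\<close> is \<open>c\<close>, and
    dividing \<open>ord g\<close> by it leaves \<open>d\<close>.\<close>
  then have "ord (g [^] c) = d"
    using ord_pow_gen[OF assms(2), of c] c by simp
  with assms(2) show ?thesis using that by blast
qed

lemma (in group) prime_order_elements_eq:
  assumes "finite (carrier G)"
  shows "prime_order_elements G = {g \<in> carrier G. ord g = 1 \<or> prime (ord g)}"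
  using ord_dvd_group_order
  by (auto simp: prime_order_elements_def prime_divisors_def)

lemma edge_prime_coprime_graph_iff:
  assumes "g \<in> carrier G" "h \<in> carrier G" "g \<noteq> h"
  shows "{g, h} \<in> snd (prime_coprime_graph G) \<longleftrightarrow>
    gcd (group.ord G g) (group.ord G h) = 1 \<or> prime (gcd (group.ord G g) (group.ord G h))"
  using assms by (auto simp: prime_coprime_graph_def doubleton_eq_iff gcd.commute)

text \<open>The gcd divides \<open>ord g\<close>, which is 1 or prime. Subsets are allowed because a
  vertex may have to be moved out of the clique to make the independent part nonempty.\<close>

lemma (in group) clique_prime_order_elements:
  assumes "finite (carrier G)" "K \<subseteq> prime_order_elements G"
  shows "clique K (snd (prime_coprime_graph G))"
  unfolding clique_def
proof (intro ballI impI)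
  fix g h assume gh: "g \<in> K" "h \<in> K" "g \<noteq> h"
  then have g: "g \<in> carrier G" "ord g = 1 \<or> prime (ord g)" and h: "h \<in> carrier G"
    using assms by (auto simp: prime_order_elements_eq)
  have "gcd (ord g) (ord h) = 1 \<or> prime (gcd (ord g) (ord h))"
    using g(2) gcd_dvd1[of "ord g" "ord h"] by (metis dvd_1_iff_1 One_nat_def prime_nat_iff)
  then show "{g, h} \<in> snd (prime_coprime_graph G)"
    using edge_prime_coprime_graph_iff[OF g(1) h gh(3)] by simp
qed

section \<open>Split partitions and the independence of the composite-order elements\<close>

lemma split_prime_coprime_graph_iff:
  "split_graph (prime_coprime_graph G) \<longleftrightarrow>
    (\<exists>K I. K \<union> I = carrier G \<and> K \<inter> I = {} \<and> K \<noteq> {} \<and> I \<noteq> {} \<and>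
      clique K (snd (prime_coprime_graph G)) \<and> indep I (snd (prime_coprime_graph G)))"
  by (simp add: split_graph_def prime_coprime_graph_def)

lemma (in group) split_prime_coprime_graph_if_indep:
  assumes fin: "finite (carrier G)" and nontriv: "carrier G \<noteq> {\<one>}"
    and indep: "indep (carrier G - prime_order_elements G) (snd (prime_coprime_graph G))"
  shows "split_graph (prime_coprime_graph G)"
proof -
  have one: "\<one> \<in> prime_order_elements G"
    using fin by (simp add: prime_order_elements_eq)
  have sub: "prime_order_elements G \<subseteq> carrier G"
    by (auto simp: prime_order_elements_def)
  show ?thesis
  proof (cases "carrier G - prime_order_elements G = {}")
    case True
    \<comment> \<open>With no composite orders the complement is empty, so a single vertex serves as
      the independent part; choosing it different from the identity keeps the clique
      nonempty.\<close>
    obtain x where x: "x \<in> carrier G" "x \<noteq> \<one>" using nontriv one_closed by blast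
    show ?thesis
      unfolding split_prime_coprime_graph_iff
    proof (intro exI conjI)
      show "carrier G - {x} \<union> {x} = carrier G" using x(1) by blast
      show "carrier G - {x} \<noteq> {}" using x(2) one_closed by blast
      show "clique (carrier G - {x}) (snd (prime_coprime_graph G))"
        using True by (intro clique_prime_order_elements fin) blast
      show "indep {x} (snd (prime_coprime_graph G))" by (simp add: indep_def)
    qed simp_all
  next
    case False
    show ?thesis
      unfolding split_prime_coprime_graph_iff
    proof (intro exI conjI)
      show "prime_order_elements G \<union> (carrier G - prime_order_elements G) = carrier G"
        using sub by (rule Diff_partition)
      show "prime_order_elements G \<inter> (carrier G - prime_order_elements G) = {}"
        by (rule Diff_disjoint)
      show "prime_order_elements G \<noteq> {}" using one by blast
      show "clique (prime_order_elements G) (snd (prime_coprime_graph G))"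
        by (intro clique_prime_order_elements fin order_refl)
    qed (fact False indep)+
  qed
qed

lemma (in group) split_graph_gcd_ord:
  assumes fin: "finite (carrier G)" and split: "split_graph (prime_coprime_graph G)"
    and g: "g \<in> carrier G - prime_order_elements G"
    and h: "h \<in> carrier G - prime_order_elements G"
  shows "gcd (ord g) (ord h) \<noteq> 1 \<and> \<not> prime (gcd (ord g) (ord h))"
proof -
  obtain K I where KI: "K \<union> I = carrier G" "clique K (snd (prime_coprime_graph G))"
    "indep I (snd (prime_coprime_graph G))"
    using split unfolding split_prime_coprime_graph_iff by blast
  have meets: "\<exists>y\<in>I. y \<in> carrier G \<and> ord y = ord x"
    if x: "x \<in> carrier G - prime_order_elements G" for x
  proof -
    have xc: "x \<in> carrier G" "ord x \<noteq> 1" "\<not> prime (ord x)"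
      using x fin by (auto simp: prime_order_elements_eq)
    have "x \<noteq> inv x"
    proof
      assume "x = inv x"
      then have "x [^] (2::nat) = \<one>"
        using xc(1) by (metis numeral_2_eq_2 nat_pow_Suc nat_pow_0 l_one r_inv)
      then have "ord x dvd 2" using xc(1) pow_eq_id by blast
      then show False using xc(2,3) two_is_prime_nat prime_nat_iff by metis
    qed
    \<comment> \<open>Both elements have order \<open>ord x\<close>, so the gcd is
      \<open>ord x\<close> itself, which is composite.\<close>
    then have "{x, inv x} \<notin> snd (prime_coprime_graph G)"
      using edge_prime_coprime_graph_iff[of x G "inv x"] xc by (simp add: ord_inv)
    then have "x \<in> I \<or> inv x \<in> I"
      using KI(1,2) xc(1) \<open>x \<noteq> inv x\<close> unfolding clique_def by blast
    then show ?thesis using xc(1) by (auto simp: ord_inv)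
  qed
  \<comment> \<open>The claim depends only on the orders, so \<open>g\<close> and \<open>h\<close>
    may be replaced by members of \<open>I\<close>. These may coincide, and then the gcd is just
    \<open>ord g\<close>.\<close>
  obtain x y where xy: "x \<in> I" "x \<in> carrier G" "ord x = ord g"
    "y \<in> I" "y \<in> carrier G" "ord y = ord h"
    using meets[OF g] meets[OF h] by blast
  show ?thesis
  proof (cases "x = y")
    case True
    then have "ord h = ord g" using xy by simp
    then show ?thesis using g fin by (auto simp: prime_order_elements_eq)
  next
    case False
    then have "{x, y} \<notin> snd (prime_coprime_graph G)"
      using KI(3) xy unfolding indep_def by blast
    then show ?thesis
      using edge_prime_coprime_graph_iff[OF xy(2,5) False] xy by simp
  qed
qed

theorem theorem3p1:
  fixes G :: "('a, 'b) monoid_scheme"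
  assumes "group G" and "finite (carrier G)" and "carrier G \<noteq> {\<one>\<^bsub>G\<^esub>}"
  shows "split_graph (prime_coprime_graph G) \<longleftrightarrow>
      carrier G - prime_order_elements G = {} \<or>
      (\<exists>p::nat. prime p \<and>
         (\<forall>g \<in> carrier G - prime_order_elements G. \<exists>k\<ge>2. group.ord G g = p ^ k)) \<or>
      (\<exists>p q::nat. prime p \<and> prime q \<and> p \<noteq> q \<and>
         (\<forall>g \<in> carrier G - prime_order_elements G. group.ord G g = p * q))"
    (is "?split \<longleftrightarrow> ?i \<or> ?ii \<or> ?iii")
proof -
  interpret group G by fact
  let ?N = "carrier G - prime_order_elements G"
  note P_eq = prime_order_elements_eq[OF assms(2)]
  \<comment> \<open>Infinite order is coded as 0, which is neither 1 nor prime; finiteness excludes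
    it.\<close>
  have ord_pos: "ord x \<noteq> 0" if "x \<in> carrier G" for x
    using ord_ge_1[OF assms(2) that] by simp
  show ?thesis
  proof
    assume split: ?split
    show "?i \<or> ?ii \<or> ?iii"
    proof (cases "?N = {}")
      case False
      have "(\<exists>p. prime p \<and> (\<forall>n\<in>ord ` ?N. \<exists>k\<ge>2. n = p ^ k)) \<or>
        (\<exists>p q. prime p \<and> prime q \<and> p \<noteq> q \<and> (\<forall>n\<in>ord ` ?N. n = p * q))"
      proof (rule composite_orders_cases)
        show "n > 0 \<and> n \<noteq> 1 \<and> \<not> prime n" if "n \<in> ord ` ?N" for n
          using that by (auto simp: P_eq ord_pos)
      next
        fix n d assume n: "n \<in> ord ` ?N" "d dvd n" and d: "d \<noteq> 1" "\<not> prime d"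
        from n obtain g where "g \<in> carrier G" "d dvd ord g" by auto
        \<comment> \<open>A power of \<open>g\<close> attains the divisor \<open>d\<close>, which
          gives closure under composite divisors.\<close>
        then obtain h where h: "h \<in> carrier G" "ord h = d"
          using ord_divisor_attained[OF assms(2)] by metis
        with d have "h \<in> ?N" by (simp add: P_eq)
        with h(2) show "d \<in> ord ` ?N" by (auto intro: image_eqI[where x = h])
      next
        show "gcd m n \<noteq> 1 \<and> \<not> prime (gcd m n)" if "m \<in> ord ` ?N" "n \<in> ord ` ?N" for m n
          using that by (elim imageE, hypsubst, intro split_graph_gcd_ord[OF assms(2) split])
      qed (use False in simp)
      then show ?thesis by simp
    qed simp
  next
    assume cases: "?i \<or> ?ii \<or> ?iii"
    have "gcd (ord g) (ord h) \<noteq> 1 \<and> \<not> prime (gcd (ord g) (ord h))"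
      if g: "g \<in> ?N" and h: "h \<in> ?N" for g h
      using cases
    proof (elim disjE exE conjE)
      assume ?i
      then show ?thesis using g by blast
    next
      fix p :: nat
      assume p: "prime p" and "\<forall>g\<in>?N. \<exists>k\<ge>2. ord g = p ^ k"
      then obtain k l where "k \<ge> 2" "ord g = p ^ k" "l \<ge> 2" "ord h = p ^ l"
        using g h by blast
      \<comment> \<open>Both exponents are at least 2, so \<open>p * p\<close> divides both
        orders.\<close>
      then have "p * p dvd gcd (ord g) (ord h)"
        by (simp add: le_imp_power_dvd flip: power2_eq_square)
      then show ?thesis by (rule prime_mult_dvd_imp_not_prime[OF p p])
    next
      fix p q :: nat
      assume pq: "prime p" "prime q" and "\<forall>g\<in>?N. ord g = p * q"
      then have "p * q dvd gcd (ord g) (ord h)" using g h by simp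
      then show ?thesis by (rule prime_mult_dvd_imp_not_prime[OF pq])
    qed
    then have "indep ?N (snd (prime_coprime_graph G))"
      unfolding indep_def using edge_prime_coprime_graph_iff[of _ G] by blast
    then show ?split
      using split_prime_coprime_graph_if_indep assms by blast
  qed
qed

end
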